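(* Any countable partial ordering can be order-embedded into $H_2$ (and, therefore, into $H_n$ for any $n\geq 2$).
   Context: $H_n$ is the free Heyting algebra on $n$ generators (propositional formulas in $x_1,\ldots,x_n$ modulo intuitionistic logical equivalence), with its usual order: $[\rho]\leq[\rho']$ iff $\rho\vdash\rho'$ intuitionistically. An order-embedding of a partial order $(P,\leq)$ into $H_n$ is a map $e\colon P\to H_n$ such that for all $p,q\in P$, $p\leq q$ iff $e(p)\leq e(q)$. *)

theory Defs
  imports "HOL-Library.Countable_Set" "HOL-Library.FuncSet"
begin

datatype fm =
    Var nat
  | Bot
  | And fm fm
  | Or fm fm
  | Imp fm fm

primrec vars :: "fm \<Rightarrow> nat set" where
  "vars (Var i) = {i}"
| "vars Bot = {}"
| "vars (And A B) = vars A \<union> vars B"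
| "vars (Or A B) = vars A \<union> vars B"
| "vars (Imp A B) = vars A \<union> vars B"

text \<open>
  Natural deduction for intuitionistic propositional logic. Negation of \<open>A\<close> is
  \<open>Imp A Bot\<close>, truth is \<open>Imp Bot Bot\<close>.
\<close>

inductive nd :: "fm set \<Rightarrow> fm \<Rightarrow> bool" (infix "\<turnstile>" 50) where
  Ax: "A \<in> \<Gamma> \<Longrightarrow> \<Gamma> \<turnstile> A"
| BotE: "\<Gamma> \<turnstile> Bot \<Longrightarrow> \<Gamma> \<turnstile> A"
| AndI: "\<Gamma> \<turnstile> A \<Longrightarrow> \<Gamma> \<turnstile> B \<Longrightarrow> \<Gamma> \<turnstile> And A B"
| AndE1: "\<Gamma> \<turnstile> And A B \<Longrightarrow> \<Gamma> \<turnstile> A"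
| AndE2: "\<Gamma> \<turnstile> And A B \<Longrightarrow> \<Gamma> \<turnstile> B"
| OrI1: "\<Gamma> \<turnstile> A \<Longrightarrow> \<Gamma> \<turnstile> Or A B"
| OrI2: "\<Gamma> \<turnstile> B \<Longrightarrow> \<Gamma> \<turnstile> Or A B"
| OrE: "\<Gamma> \<turnstile> Or A B \<Longrightarrow> insert A \<Gamma> \<turnstile> C \<Longrightarrow> insert B \<Gamma> \<turnstile> C \<Longrightarrow> \<Gamma> \<turnstile> C"
| ImpI: "insert A \<Gamma> \<turnstile> B \<Longrightarrow> \<Gamma> \<turnstile> Imp A B"
| ImpE: "\<Gamma> \<turnstile> Imp A B \<Longrightarrow> \<Gamma> \<turnstile> A \<Longrightarrow> \<Gamma> \<turnstile> B"

definition Fm :: "nat \<Rightarrow> fm set" where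
  "Fm n = {A. vars A \<subseteq> {1..n}}"

definition int_equiv :: "nat \<Rightarrow> (fm \<times> fm) set" where
  "int_equiv n = {(A, B). A \<in> Fm n \<and> B \<in> Fm n \<and> {A} \<turnstile> B \<and> {B} \<turnstile> A}"

definition H :: "nat \<Rightarrow> fm set set" where
  "H n = Fm n // int_equiv n"

text \<open>
  The order is stated through representatives; it does not depend on their choice, see
  \<open>H_le_class_iff\<close> below.
\<close>

definition H_le :: "fm set \<Rightarrow> fm set \<Rightarrow> bool" where
  "H_le X Y \<longleftrightarrow> (\<exists>A\<in>X. \<exists>B\<in>Y. {A} \<turnstile> B)"

definition order_embedding_into_H :: "nat \<Rightarrow> 'a set \<Rightarrow> 'a rel \<Rightarrow> ('a \<Rightarrow> fm set) \<Rightarrow> bool" where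
  "order_embedding_into_H n P r e \<longleftrightarrow>
     e \<in> P \<rightarrow> H n \<and> (\<forall>p\<in>P. \<forall>q\<in>P. (p, q) \<in> r \<longleftrightarrow> H_le (e p) (e q))"

lemma nd_cut:
  assumes "{A} \<turnstile> B" "{B} \<turnstile> C"
  shows "{A} \<turnstile> C"
proof -
  have weaken: "\<Delta> \<turnstile> D" if "\<Gamma> \<turnstile> D" "\<Gamma> \<subseteq> \<Delta>" for \<Gamma> \<Delta> D
    using that
  proof (induction arbitrary: \<Delta> rule: nd.induct)
    case (OrE \<Gamma> A B C)
    then show ?case by (meson nd.OrE insert_mono)
  next
    case (ImpI A \<Gamma> B)
    then show ?case by (meson nd.ImpI insert_mono)
  qed (blast intro: nd.intros)+
  have "{A} \<turnstile> Imp B C"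
    using weaken[OF assms(2), of "{B, A}"] by (auto intro: nd.ImpI)
  with assms(1) show ?thesis by (blast intro: nd.ImpE)
qed

lemma equiv_int_equiv: "equiv (Fm n) (int_equiv n)"
  by (rule equivI)
    (auto simp: int_equiv_def refl_on_def sym_def trans_def intro: nd.Ax nd_cut)

lemma H_le_class_iff:
  assumes "A \<in> Fm n" "B \<in> Fm n"
  shows "H_le (int_equiv n `` {A}) (int_equiv n `` {B}) \<longleftrightarrow> {A} \<turnstile> B"
  using assms by (auto simp: H_le_def int_equiv_def intro: nd.Ax nd_cut)

end

theory Submission imports Defs begin

text \<open>
  The proof has two independent halves.

  The first produces a sequence of formulas \<open>split_fm 0, split_fm 1, \<dots>\<close> in the variables
  \<open>x = Var 1\<close> and \<open>y = Var 2\<close> that are independent with respect to meet and join: in one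
  Kripke model every set \<open>T\<close> of natural numbers has a world \<open>Root T\<close> which refutes exactly the
  \<open>split_fm n\<close> with \<open>n \<in> T\<close> (lemma \<open>forces_split_fm\<close>). The upper part of the model is the
  Rieger--Nishimura ladder, on which formulas in \<open>x\<close> alone cut out every finite initial segment
  and hence tell all rungs apart. The variable \<open>y\<close> marks the ladder; below it there is room for
  worlds that see arbitrary sets of rungs, and a formula of the shape
  \<open>(y \<longrightarrow> B) \<longrightarrow> (y \<longrightarrow> C) \<or> y\<close> lets such a world detect whether one given rung is in its set.

  The second half embeds a countable order into the lattice generated by any such sequence \<open>a\<close>.
  The elements are enumerated, and the \<open>n\<close>-th one is sent to \<open>a n\<close>, cut down to the meet of the
  images of the earlier elements above it and then joined with the images of the earlier elements
  below it. This makes the map monotone. Conversely, if \<open>p\<close> is not below \<open>q\<close>, take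
  the world that forces \<open>a i\<close> exactly when \<open>p\<close> is below \<open>i\<close>. Since the upward closure of \<open>p\<close>
  already respects all the meets and joins in the construction, this world forces the image
  of \<open>i\<close> exactly when \<open>p\<close> is below \<open>i\<close>; so it separates the image of \<open>p\<close> from that of \<open>q\<close>, and
  soundness of Kripke semantics excludes a derivation.
\<close>

section \<open>Lattice reasoning in natural deduction\<close>

lemma nd_weaken: "\<Gamma> \<turnstile> A \<Longrightarrow> \<Gamma> \<subseteq> \<Delta> \<Longrightarrow> \<Delta> \<turnstile> A"
proof (induction arbitrary: \<Delta> rule: nd.induct)
  case (OrE \<Gamma> A B C)
  then show ?case by (meson nd.OrE insert_mono)
next
  case (ImpI A \<Gamma> B)
  then show ?case by (meson nd.ImpI insert_mono)
qed (blast intro: nd.intros)+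

lemma nd_Or_least:
  assumes "{A} \<turnstile> C" "{B} \<turnstile> C"
  shows "{Or A B} \<turnstile> C"
  by (rule nd.OrE[where A = A and B = B])
    (auto intro: nd.Ax nd_weaken[OF assms(1)] nd_weaken[OF assms(2)])

definition conj_list :: "fm list \<Rightarrow> fm" where
  "conj_list As = foldr And As (Imp Bot Bot)"

definition disj_list :: "fm list \<Rightarrow> fm" where
  "disj_list As = foldr Or As Bot"

lemma nd_conj_list_lower: "A \<in> set As \<Longrightarrow> {conj_list As} \<turnstile> A"
proof (induction As)
  case (Cons B As)
  have "{conj_list (B # As)} \<turnstile> B" "{conj_list (B # As)} \<turnstile> conj_list As"
    by (auto simp: conj_list_def intro: nd.Ax nd.AndE1 nd.AndE2)
  with Cons show ?case by (auto intro: nd_cut)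
qed simp

lemma nd_disj_list_upper: "A \<in> set As \<Longrightarrow> {A} \<turnstile> disj_list As"
  by (induction As) (auto simp: disj_list_def intro: nd.Ax nd.OrI1 nd.OrI2)

lemma nd_disj_list_least: "(\<And>A. A \<in> set As \<Longrightarrow> {A} \<turnstile> C) \<Longrightarrow> {disj_list As} \<turnstile> C"
  by (induction As) (auto simp: disj_list_def intro: nd.Ax nd.BotE nd_Or_least)

lemma vars_conj_list: "vars (conj_list As) = (\<Union>A\<in>set As. vars A)"
  by (induction As) (auto simp: conj_list_def)

lemma vars_disj_list: "vars (disj_list As) = (\<Union>A\<in>set As. vars A)"
  by (induction As) (auto simp: disj_list_def)

section \<open>Kripke semantics\<close>

primrec forces :: "('w \<Rightarrow> 'w \<Rightarrow> bool) \<Rightarrow> (nat \<Rightarrow> 'w \<Rightarrow> bool) \<Rightarrow> 'w \<Rightarrow> fm \<Rightarrow> bool" where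
  "forces R V w (Var i) \<longleftrightarrow> V i w"
| "forces R V w Bot \<longleftrightarrow> False"
| "forces R V w (And A B) \<longleftrightarrow> forces R V w A \<and> forces R V w B"
| "forces R V w (Or A B) \<longleftrightarrow> forces R V w A \<or> forces R V w B"
| "forces R V w (Imp A B) \<longleftrightarrow> (\<forall>v. R w v \<longrightarrow> forces R V v A \<longrightarrow> forces R V v B)"

lemma forces_conj_list: "forces R V w (conj_list As) \<longleftrightarrow> (\<forall>A\<in>set As. forces R V w A)"
  by (induction As) (auto simp: conj_list_def)

lemma forces_disj_list: "forces R V w (disj_list As) \<longleftrightarrow> (\<exists>A\<in>set As. forces R V w A)"
  by (induction As) (auto simp: disj_list_def)

definition kripke :: "('w \<Rightarrow> 'w \<Rightarrow> bool) \<Rightarrow> (nat \<Rightarrow> 'w \<Rightarrow> bool) \<Rightarrow> bool" where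
  "kripke R V \<longleftrightarrow> reflp R \<and> transp R \<and> (\<forall>i w v. R w v \<longrightarrow> V i w \<longrightarrow> V i v)"

lemma forces_persistent:
  assumes "kripke R V" "R w v" "forces R V w A"
  shows "forces R V v A"
  using assms by (induction A) (auto simp: kripke_def dest: transpD)

lemma soundness:
  assumes "kripke R V" "\<Gamma> \<turnstile> A" "\<And>B. B \<in> \<Gamma> \<Longrightarrow> forces R V w B"
  shows "forces R V w A"
  using assms(2,3)
proof (induction arbitrary: w rule: nd.induct)
  case (OrE \<Gamma> A B C)
  then show ?case by (metis forces.simps(4) insertE)
next
  case (ImpI A \<Gamma> B)
  have "forces R V v B" if "R w v" "forces R V v A" for v
  proof (rule ImpI.IH)
    fix C assume "C \<in> insert A \<Gamma>"
    then show "forces R V v C"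
      using that forces_persistent[OF assms(1)] ImpI.prems by blast
  qed
  then show ?case by simp
next
  case (ImpE \<Gamma> A B)
  have "R w w" using assms(1) by (simp add: kripke_def reflpD)
  with ImpE show ?case by (metis forces.simps(5))
qed auto

section \<open>A model with an independent sequence of formulas\<close>

text \<open>
  The rungs form the Rieger--Nishimura ladder, in which a rung sees itself and every
  earlier rung except its predecessor. A root stands for a set of rungs; it sees these rungs,
  whatever they see, and the roots of all subsets.
\<close>

datatype world = Rung nat | Root "nat set"

fun sees :: "world \<Rightarrow> world \<Rightarrow> bool" where
  "sees (Rung k) (Rung l) \<longleftrightarrow> l = k \<or> l + 2 \<le> k"
| "sees (Rung k) (Root T) \<longleftrightarrow> False"
| "sees (Root S) (Rung l) \<longleftrightarrow> (\<exists>k\<in>S. l = k \<or> l + 2 \<le> k)"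
| "sees (Root S) (Root T) \<longleftrightarrow> T \<subseteq> S"

definition val :: "nat \<Rightarrow> world \<Rightarrow> bool" where
  "val i w \<longleftrightarrow> i = 1 \<and> w = Rung 0 \<or> i = 2 \<and> w \<in> range Rung"

lemma kripke_ladder: "kripke sees val"
proof -
  have "sees w w" for w by (cases w) auto
  moreover have "sees u w" if "sees u v" "sees v w" for u v w
  proof (cases "\<exists>S j l. u = Root S \<and> v = Rung j \<and> w = Rung l")
    case True
    then obtain S j l where "u = Root S" "v = Rung j" "w = Rung l" by blast
    moreover from this that obtain k where "k \<in> S" "j = k \<or> j + 2 \<le> k" by auto
    ultimately show ?thesis using that(2) by (auto intro!: bexI[of _ k])
  next
    case False
    with that show ?thesis by (cases u; cases v; cases w) auto
  qed
  moreover have "val i v" if "sees w v" "val i w" for i w v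
    using that by (cases w; cases v) (auto simp: val_def)
  ultimately show ?thesis
    unfolding kripke_def by (blast intro: reflpI transpI)
qed

text \<open>
  The Nishimura formulas that define the initial segments of the ladder. The induction behind
  \<open>forces_segment_fm\<close> works because \<open>n + 1\<close> is the only rung beyond \<open>n\<close> that does not see
  \<open>n\<close>: adding to a segment the rungs that do not see its last element prolongs it by one.
\<close>

fun segment_fm :: "nat \<Rightarrow> fm" where
  "segment_fm 0 = Bot"
| "segment_fm (Suc 0) = Var 1"
| "segment_fm (Suc (Suc n)) =
     Or (segment_fm (Suc n)) (Imp (segment_fm (Suc n)) (segment_fm n))"

lemma forces_segment_fm: "forces sees val (Rung k) (segment_fm n) \<longleftrightarrow> k < n"
proof (induction n arbitrary: k rule: segment_fm.induct)
  case (3 n)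
  have "forces sees val (Rung k) (Imp (segment_fm (Suc n)) (segment_fm n)) \<longleftrightarrow>
      \<not> sees (Rung k) (Rung n)"
    (is "?L \<longleftrightarrow> ?R")
  proof
    assume ?L
    then show ?R using 3 by (metis forces.simps(5) lessI less_irrefl)
  next
    assume ?R
    show ?L unfolding forces.simps
    proof (intro allI impI)
      fix v assume v: "sees (Rung k) v" "forces sees val v (segment_fm (Suc n))"
      then obtain l where "v = Rung l" by (cases v) auto
      moreover from this v(2) have "l \<le> n" by (simp add: 3 less_Suc_eq_le)
      moreover have "l \<noteq> n" using v(1) \<open>?R\<close> \<open>v = Rung l\<close> by blast
      ultimately show "forces sees val v (segment_fm n)" by (simp add: 3)
    qed
  qed
  then show ?case
    unfolding segment_fm.simps forces.simps(4) 3 by auto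
qed (auto simp: val_def)

lemma vars_segment_fm: "vars (segment_fm n) \<subseteq> {1}"
  by (induction n rule: segment_fm.induct) auto

text \<open>
  A root refutes this formula exactly if it sees a root whose set is contained in
  \<open>{..n}\<close> but not in \<open>{..<n}\<close>. The singleton of \<open>n\<close> is the smallest such set, and each such
  set contains \<open>n\<close>. The disjunct \<open>y\<close> makes the formula hold throughout the ladder.
\<close>

definition split_fm :: "nat \<Rightarrow> fm" where
  "split_fm n = Imp (Imp (Var 2) (segment_fm (Suc n)))
                    (Or (Imp (Var 2) (segment_fm n)) (Var 2))"

lemma vars_split_fm: "vars (split_fm n) \<subseteq> {1..2}"
  using vars_segment_fm[of n] vars_segment_fm[of "Suc n"] by (auto simp: split_fm_def)

lemma forces_y_imp_segment_fm:
  "forces sees val (Root S) (Imp (Var 2) (segment_fm n)) \<longleftrightarrow> S \<subseteq> {..<n}"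
proof -
  have "forces sees val (Root S) (Imp (Var 2) (segment_fm n)) \<longleftrightarrow>
      (\<forall>l. sees (Root S) (Rung l) \<longrightarrow> l < n)"
    by (force simp: val_def forces_segment_fm[symmetric] simp del: sees.simps)
  also have "\<dots> \<longleftrightarrow> S \<subseteq> {..<n}" by fastforce
  finally show ?thesis .
qed

lemma forces_split_fm: "forces sees val (Root T) (split_fm n) \<longleftrightarrow> n \<notin> T"
proof -
  have rung: "forces sees val (Rung l) (Var 2)" for l
    by (simp add: val_def)
  have root: "\<not> forces sees val (Root S) (Var 2)" for S
    by (auto simp: val_def)
  have "forces sees val (Root T) (split_fm n) \<longleftrightarrow>
      (\<forall>S\<subseteq>T. S \<subseteq> {..<Suc n} \<longrightarrow> S \<subseteq> {..<n})"
    (is "_ \<longleftrightarrow> ?R")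
  proof
    assume "forces sees val (Root T) (split_fm n)"
    then have "forces sees val (Root S) (Or (Imp (Var 2) (segment_fm n)) (Var 2))"
      if "sees (Root T) (Root S)" "forces sees val (Root S) (Imp (Var 2) (segment_fm (Suc n)))"
      for S
      using that unfolding split_fm_def forces.simps(5)[of _ _ "Root T"] by blast
    then show ?R
      unfolding forces_y_imp_segment_fm forces.simps(4) sees.simps using root by blast
  next
    assume R: ?R
    show "forces sees val (Root T) (split_fm n)"
      unfolding split_fm_def forces.simps(5)[of _ _ "Root T"]
    proof (intro allI impI)
      fix v assume "sees (Root T) v" "forces sees val v (Imp (Var 2) (segment_fm (Suc n)))"
      then show "forces sees val v (Or (Imp (Var 2) (segment_fm n)) (Var 2))"
        using R rung
        by (cases v) (simp_all only: forces_y_imp_segment_fm forces.simps(4) sees.simps simp_thms)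
    qed
  qed
  also have "\<dots> \<longleftrightarrow> n \<notin> T"
  proof
    assume "\<forall>S\<subseteq>T. S \<subseteq> {..<Suc n} \<longrightarrow> S \<subseteq> {..<n}"
    from this[rule_format, of "{n}"] show "n \<notin> T" by auto
  next
    assume "n \<notin> T"
    then show "\<forall>S\<subseteq>T. S \<subseteq> {..<Suc n} \<longrightarrow> S \<subseteq> {..<n}"
      unfolding lessThan_Suc by blast
  qed
  finally show ?thesis .
qed

section \<open>Embedding a countable order by inserting one element at a time\<close>

fun insertion_fm :: "(nat \<Rightarrow> fm) \<Rightarrow> (nat \<Rightarrow> nat \<Rightarrow> bool) \<Rightarrow> nat \<Rightarrow> fm" where
  "insertion_fm a R n =
     Or (And (a n) (conj_list (map (insertion_fm a R) (filter (\<lambda>i. R n i) [0..<n]))))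
        (disj_list (map (insertion_fm a R) (filter (\<lambda>i. R i n) [0..<n])))"

declare insertion_fm.simps [simp del]

lemma vars_insertion_fm:
  assumes "\<And>n. vars (a n) \<subseteq> X"
  shows "vars (insertion_fm a R n) \<subseteq> X"
proof (induction n rule: less_induct)
  case (less n)
  then show ?case
    using assms by (subst insertion_fm.simps) (auto simp: vars_conj_list vars_disj_list)
qed

lemma insertion_fm_mono:
  assumes "transp R" "R m n"
  shows "{insertion_fm a R m} \<turnstile> insertion_fm a R n"
  using assms(2)
proof (induction "max m n" arbitrary: m n rule: less_induct)
  case less
  consider "m < n" | "m = n" | "n < m" by linarith
  then show ?case
  proof cases
    case 1
    then have "insertion_fm a R m \<in> set (map (insertion_fm a R) (filter (\<lambda>i. R i n) [0..<n]))"
      using less.prems by auto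
    from nd_disj_list_upper[OF this] show ?thesis
      by (subst (2) insertion_fm.simps) (rule nd.OrI2)
  next
    case 2
    then show ?thesis by (simp add: nd.Ax)
  next
    case 3
    then have above: "insertion_fm a R n \<in> set (map (insertion_fm a R) (filter (\<lambda>i. R m i) [0..<m]))"
      using less.prems by auto
    have "{And (a m) (conj_list (map (insertion_fm a R) (filter (\<lambda>i. R m i) [0..<m])))}
        \<turnstile> insertion_fm a R n"
      by (rule nd_cut[OF _ nd_conj_list_lower[OF above]]) (auto intro: nd.Ax nd.AndE2)
    \<comment> \<open>An earlier element below \<open>m\<close> is also below \<open>n\<close>, and both precede \<open>m\<close> in the enumeration.\<close>
    moreover have "{disj_list (map (insertion_fm a R) (filter (\<lambda>i. R i m) [0..<m]))}
        \<turnstile> insertion_fm a R n"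
      using 3 less transpD[OF assms(1)] by (intro nd_disj_list_least) auto
    ultimately show ?thesis
      by (subst insertion_fm.simps) (rule nd_Or_least)
  qed
qed

text \<open>
  At a world where the formulas \<open>a i\<close> hold on an upward closed set of indices, the value
  prescribed by \<open>a n\<close> is compatible with those of the earlier elements above and below \<open>n\<close>, so
  meet and join leave it unchanged.
\<close>

lemma forces_insertion_fm:
  assumes a: "\<And>i. forces S V w (a i) \<longleftrightarrow> i \<in> U"
    and U: "\<And>i j. i \<in> U \<Longrightarrow> R i j \<Longrightarrow> j \<in> U"
  shows "forces S V w (insertion_fm a R n) \<longleftrightarrow> n \<in> U"
proof (induction n rule: less_induct)
  case (less n)
  then show ?case
    using U by (subst insertion_fm.simps) (auto simp: a forces_conj_list forces_disj_list)
qed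

lemma insertion_split_fm_le_iff:
  assumes "reflp R" "transp R"
  shows "{insertion_fm split_fm R m} \<turnstile> insertion_fm split_fm R n \<longleftrightarrow> R m n"
proof
  assume derivation: "{insertion_fm split_fm R m} \<turnstile> insertion_fm split_fm R n"
  have forces_iff: "forces sees val (Root {i. \<not> R m i}) (insertion_fm split_fm R k) \<longleftrightarrow>
      k \<in> {i. R m i}" for k
    by (rule forces_insertion_fm) (auto simp: forces_split_fm dest: transpD[OF assms(2)])
  have "forces sees val (Root {i. \<not> R m i}) (insertion_fm split_fm R n)"
    using soundness[OF kripke_ladder derivation] forces_iff reflpD[OF assms(1)] by auto
  then show "R m n" by (simp add: forces_iff)
next
  assume "R m n"
  then show "{insertion_fm split_fm R m} \<turnstile> insertion_fm split_fm R n"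
    by (rule insertion_fm_mono[OF assms(2)])
qed

lemma order_embedding_into_H_of_countable:
  fixes P :: "'a set" and r :: "'a rel"
  assumes "partial_order_on P r" "countable P" "2 \<le> n"
  shows "\<exists>e. order_embedding_into_H n P r e"
proof -
  define f where "f = to_nat_on P"
  have inj: "inj_on f P"
    unfolding f_def by (rule inj_on_to_nat_on[OF assms(2)])
  have refl: "refl_on P r" and trans: "trans r"
    using assms(1) by (auto simp: partial_order_on_def preorder_on_def)
  \<comment> \<open>The order transported to indices; an index that enumerates no element is comparable only
    to itself.\<close>
  define R where "R i j \<longleftrightarrow> i = j \<or> (\<exists>p\<in>P. \<exists>q\<in>P. f p = i \<and> f q = j \<and> (p, q) \<in> r)" for i j
  have "reflp R" by (auto simp: R_def intro: reflpI)
  have "transp R"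
  proof (rule transpI)
    fix i j k assume "R i j" "R j k"
    then show "R i k"
      unfolding R_def by (metis inj inj_onD trans transD)
  qed
  have R_iff: "R (f p) (f q) \<longleftrightarrow> (p, q) \<in> r" if "p \<in> P" "q \<in> P" for p q
    using that inj_onD[OF inj] refl_onD[OF refl] unfolding R_def by metis
  define E where "E p = insertion_fm split_fm R (f p)" for p
  have E: "E p \<in> Fm n" for p
    using vars_insertion_fm[OF vars_split_fm, where R = R and n = "f p"] assms(3)
    by (fastforce simp: E_def Fm_def)
  have "order_embedding_into_H n P r (\<lambda>p. int_equiv n `` {E p})"
    unfolding order_embedding_into_H_def
  proof (intro conjI ballI)
    show "(\<lambda>p. int_equiv n `` {E p}) \<in> P \<rightarrow> H n"
      using E by (auto simp: H_def intro: quotientI)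
  next
    fix p q assume "p \<in> P" "q \<in> P"
    then show "(p, q) \<in> r \<longleftrightarrow> H_le (int_equiv n `` {E p}) (int_equiv n `` {E q})"
      using insertion_split_fm_le_iff[OF \<open>reflp R\<close> \<open>transp R\<close>]
      by (simp add: H_le_class_iff E R_iff) (simp add: E_def R_iff)
  qed
  then show ?thesis by (rule exI[where P = "order_embedding_into_H n P r"])
qed

theorem proposition18:
  fixes P :: "'a set" and r :: "'a rel"
  assumes "partial_order_on P r" and "countable P"
  shows "(\<exists>e. order_embedding_into_H 2 P r e) \<and>
         (\<forall>n\<ge>2. \<exists>e. order_embedding_into_H n P r e)"
  using order_embedding_into_H_of_countable[OF assms] by blast

end
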